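(* For every sufficiently large integer $n$, \[ 0.03125 \leq \mathbf{d}(Q_n, C_6, C_4) \leq 0.1625. \]
   Context: $Q_n$ denotes the $n$-dimensional hypercube: its vertices are the binary vectors of length $n$, two vectors being adjacent iff they differ in exactly one coordinate. $C_m$ is the cycle on $m$ vertices. For graphs $G$ and $T$, a copy of $T$ in $G$ is a subgraph of $G$ isomorphic to $T$, and $N(G,T)$ is the number of copies of $T$ in $G$. A graph is $H$-free if it has no subgraph isomorphic to $H$. For subgraphs $T,H$ of $G$, $\mathrm{ex}(G,T,H)=\max\{N(G',T): G'\subseteq G,\ G' \text{ is } H\text{-free}\}$ and $\mathbf{d}(G,T,H)=\mathrm{ex}(G,T,H)/N(G,T)$. *)

theory Defs
  imports Complex_Main
begin

type_synonym 'a ugraph = "'a set \<times> 'a set set"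

abbreviation verts :: "'a ugraph \<Rightarrow> 'a set" where
  "verts G \<equiv> fst G"

abbreviation edges :: "'a ugraph \<Rightarrow> 'a set set" where
  "edges G \<equiv> snd G"

definition simple_graph :: "'a ugraph \<Rightarrow> bool" where
  "simple_graph G \<longleftrightarrow> (\<forall>e\<in>edges G. e \<subseteq> verts G \<and> card e = 2)"

text \<open>Subgraphs need not be induced or spanning.\<close>

definition subgraph :: "'a ugraph \<Rightarrow> 'a ugraph \<Rightarrow> bool" where
  "subgraph S G \<longleftrightarrow> simple_graph S \<and> verts S \<subseteq> verts G \<and> edges S \<subseteq> edges G"

definition isomorphic :: "'a ugraph \<Rightarrow> 'b ugraph \<Rightarrow> bool" where
  "isomorphic G H \<longleftrightarrow>
     (\<exists>f. bij_betw f (verts G) (verts H) \<and>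
          (\<forall>u\<in>verts G. \<forall>v\<in>verts G. {u, v} \<in> edges G \<longleftrightarrow> {f u, f v} \<in> edges H))"

definition copies :: "'a ugraph \<Rightarrow> 'b ugraph \<Rightarrow> 'a ugraph set" where
  "copies G T = {S. subgraph S G \<and> isomorphic S T}"

definition num_copies :: "'a ugraph \<Rightarrow> 'b ugraph \<Rightarrow> nat" where
  "num_copies G T = card (copies G T)"

definition free_of :: "'a ugraph \<Rightarrow> 'b ugraph \<Rightarrow> bool" where
  "free_of G H \<longleftrightarrow> \<not> (\<exists>S. subgraph S G \<and> isomorphic S H)"

text \<open>The maximum is meant for finite \<open>G\<close> and for \<open>H\<close> with at least one vertex; the set below is
  then finite and nonempty (see \<open>ex_set_finite\<close> and \<open>ex_set_nonempty\<close>).\<close>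

definition ex_copies :: "'a ugraph \<Rightarrow> 'b ugraph \<Rightarrow> 'c ugraph \<Rightarrow> nat" where
  "ex_copies G T H = Max {num_copies G' T | G'. subgraph G' G \<and> free_of G' H}"

definition turan_density :: "'a ugraph \<Rightarrow> 'b ugraph \<Rightarrow> 'c ugraph \<Rightarrow> real" where
  "turan_density G T H = real (ex_copies G T H) / real (num_copies G T)"

definition hypercube :: "nat \<Rightarrow> bool list ugraph" where
  "hypercube n =
     ({x. length x = n},
      {{x, y} | x y. length x = n \<and> length y = n \<and> card {i. i < n \<and> x ! i \<noteq> y ! i} = 1})"

text \<open>The cycle is meant for \<open>m \<ge> 3\<close>.\<close>

definition cycle_graph :: "nat \<Rightarrow> nat ugraph" where
  "cycle_graph m = ({..<m}, {{i, Suc i mod m} | i. i < m})"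

lemma simple_graph_hypercube: "simple_graph (hypercube n)"
proof -
  have "x \<noteq> y" if "card {i. i < n \<and> x ! i \<noteq> y ! i} = 1" for x y :: "bool list"
    using that by auto
  then show ?thesis
    unfolding simple_graph_def hypercube_def by (fastforce simp: card_2_iff)
qed

lemma finite_verts_hypercube: "finite (verts (hypercube n))"
  using finite_lists_length_eq[of "UNIV :: bool set" n] by (simp add: hypercube_def)

lemma simple_graph_cycle_graph:
  assumes "m \<ge> 3"
  shows "simple_graph (cycle_graph m)"
proof -
  have "i \<noteq> Suc i mod m" if "i < m" for i
    using that assms by (cases "Suc i = m") auto
  then show ?thesis
    using assms unfolding simple_graph_def cycle_graph_def by (auto simp: card_2_iff)
qed

lemma ex_set_finite:
  assumes "finite (verts G)"
  shows "finite {num_copies G' T | G'. subgraph G' G \<and> free_of G' H}"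
proof -
  have "{G'. subgraph G' G} \<subseteq> Pow (verts G) \<times> Pow (Pow (verts G))"
    unfolding subgraph_def simple_graph_def by fastforce
  then have "finite {G'. subgraph G' G}"
    by (rule finite_subset) (use assms in simp)
  then have "finite ((\<lambda>G'. num_copies G' T) ` {G'. subgraph G' G})"
    by simp
  then show ?thesis
    by (rule rev_finite_subset) auto
qed

lemma ex_set_nonempty:
  assumes "verts H \<noteq> {}"
  shows "{num_copies G' T | G'. subgraph G' G \<and> free_of G' H} \<noteq> {}"
proof -
  have "subgraph ({}, {}) G"
    by (simp add: subgraph_def simple_graph_def)
  moreover have "free_of ({}, {}) H"
    using assms by (auto simp: free_of_def subgraph_def isomorphic_def bij_betw_def)
  ultimately show ?thesis by blast
qed

end

theory Submission
  imports Defs "HOL-Library.FuncSet"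
begin

text \<open>The number of embeddings of \<open>C\<^sub>6\<close> into a graph is the number of copies times the number of
  automorphisms of \<open>C\<^sub>6\<close>, so the density is a quotient of numbers of embeddings. In the hypercube an
  embedding is given by its first vertex and the six directions of its edges, which involve three
  distinct directions \<open>a, b, c\<close>; hence \<open>Q\<^sub>n\<close> has \<open>4 \<cdot> 2\<^sup>n \<cdot> n (n - 1) (n - 2)\<close> of them.

  Lower bound: keep only the edges between the layers \<open>2k\<close> and \<open>2k + 1\<close>. Two edges in direction \<open>b\<close>
  that are opposite in a square are never both kept, so there is no \<open>C\<^sub>4\<close>, and for given \<open>a, b, c\<close>
  exactly one eighth of the starting vertices give a hexagon with direction word \<open>abcabc\<close>.

  Upper bound: a \<open>C\<^sub>4\<close>-free subgraph of \<open>Q\<^sub>3\<close> with \<open>N\<close> hexagons, \<open>S\<close> vertices of degree 3 and \<open>m\<close> edges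
  satisfies \<open>24 N + 9 S \<le> 10 m\<close>. Summing over all subcubes bounds the number of hexagons by a sum over
  the vertices of a cubic polynomial in the degree. The negative cubic term counts triples of edges
  at a vertex; it is what improves the bound \<open>1/6\<close> that counting pairs of edges gives.\<close>

section \<open>Copies and embeddings\<close>

text \<open>Functions are extensional, so that an embedding is determined by its values on the
  vertices of \<open>T\<close> and can be counted.\<close>

definition embeddings :: "'b ugraph \<Rightarrow> 'a ugraph \<Rightarrow> ('b \<Rightarrow> 'a) set" where
  "embeddings T G =
     {f \<in> verts T \<rightarrow>\<^sub>E verts G. inj_on f (verts T) \<and> (\<forall>e\<in>edges T. f ` e \<in> edges G)}"

definition automorphisms :: "'b ugraph \<Rightarrow> ('b \<Rightarrow> 'b) set" where
  "automorphisms T =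
     {h \<in> verts T \<rightarrow>\<^sub>E verts T. bij_betw h (verts T) (verts T) \<and> (`) h ` edges T = edges T}"

definition image_graph :: "('b \<Rightarrow> 'a) \<Rightarrow> 'b ugraph \<Rightarrow> 'a ugraph" where
  "image_graph f T = (f ` verts T, (`) f ` edges T)"

lemma simple_graph_edgeE:
  assumes "simple_graph G" "e \<in> edges G"
  obtains u v where "e = {u, v}" "u \<noteq> v" "u \<in> verts G" "v \<in> verts G"
  using assms unfolding simple_graph_def by (metis card_2_iff insert_subset)

text \<open>Inverting an isomorphism from a copy onto \<open>T\<close> gives an embedding with that
  copy as its image. Conversely, injectivity makes an embedding reflect the edges of its image, so
  its inverse is an isomorphism.\<close>

lemma copies_eq_image_graph:
  assumes T: "simple_graph T"
  shows "copies G T = (\<lambda>f. image_graph f T) ` embeddings T G"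
proof (intro equalityI subsetI)
  fix S assume "S \<in> copies G T"
  then have S: "simple_graph S" "verts S \<subseteq> verts G" "edges S \<subseteq> edges G" and "isomorphic S T"
    by (auto simp: copies_def subgraph_def)
  then obtain g where g: "bij_betw g (verts S) (verts T)"
    and ge: "\<And>u v. u \<in> verts S \<Longrightarrow> v \<in> verts S \<Longrightarrow> {u, v} \<in> edges S \<longleftrightarrow> {g u, g v} \<in> edges T"
    unfolding isomorphic_def by blast
  define f where "f = restrict (inv_into (verts S) g) (verts T)"
  have f: "bij_betw f (verts T) (verts S)"
    unfolding f_def using g by (simp add: bij_betw_inv_into)
  have gf: "g (f t) = t" if "t \<in> verts T" for t
    using g that unfolding f_def by (simp add: bij_betw_inv_into_right)
  have fg: "f (g s) = s" "g s \<in> verts T" if "s \<in> verts S" for s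
    using g that unfolding f_def by (auto simp: bij_betw_inv_into_left bij_betwE)
  have fS: "f t \<in> verts S" if "t \<in> verts T" for t
    using f that by (auto simp: bij_betw_def)
  have eT: "f ` e \<in> edges S" if "e \<in> edges T" for e
    using T that
  proof (rule simple_graph_edgeE)
    fix u v assume e: "e = {u, v}" "u \<in> verts T" "v \<in> verts T"
    then show ?thesis using that ge[of "f u" "f v"] fS gf by auto
  qed
  have eS: "e \<in> (`) f ` edges T" if "e \<in> edges S" for e
    using S(1) that
  proof (rule simple_graph_edgeE)
    fix u v assume e: "e = {u, v}" "u \<in> verts S" "v \<in> verts S"
    then have "{g u, g v} \<in> edges T" "e = f ` {g u, g v}" using that ge fg by auto
    then show ?thesis by blast
  qed
  have "f \<in> embeddings T G"
    using f S eT fS by (auto simp: embeddings_def bij_betw_def f_def)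
  moreover have "S = image_graph f T"
    using f eT eS by (auto simp: image_graph_def bij_betw_def prod_eq_iff)
  ultimately show "S \<in> (\<lambda>f. image_graph f T) ` embeddings T G" by blast
next
  fix S assume "S \<in> (\<lambda>f. image_graph f T) ` embeddings T G"
  then obtain f where f: "f \<in> embeddings T G" and S: "S = image_graph f T" by blast
  have inj: "inj_on f (verts T)" and fG: "f ` verts T \<subseteq> verts G"
    and fe: "\<And>e. e \<in> edges T \<Longrightarrow> f ` e \<in> edges G"
    using f by (auto simp: embeddings_def)
  have "f ` e \<subseteq> f ` verts T \<and> card (f ` e) = 2" if "e \<in> edges T" for e
    using T that inj unfolding simple_graph_def by (metis card_image image_mono inj_on_subset)
  then have "subgraph S G"
    using fG fe by (auto simp: subgraph_def simple_graph_def S image_graph_def)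
  moreover have "isomorphic S T"
    unfolding isomorphic_def
  proof (intro exI conjI ballI)
    show "bij_betw (inv_into (verts T) f) (verts S) (verts T)"
      using inj by (simp add: S image_graph_def bij_betw_inv_into inj_on_imp_bij_betw)
    fix x y assume "x \<in> verts S" "y \<in> verts S"
    then obtain u v where uv: "x = f u" "y = f v" "u \<in> verts T" "v \<in> verts T"
      by (auto simp: S image_graph_def)
    have "{f u, f v} \<in> edges S \<longleftrightarrow> {u, v} \<in> edges T"
    proof
      assume "{f u, f v} \<in> edges S"
      then obtain e where e: "e \<in> edges T" "f ` {u, v} = f ` e"
        by (auto simp: S image_graph_def)
      then have "e \<subseteq> verts T" using T by (auto simp: simple_graph_def)
      then have "e = {u, v}"
        using inj_on_image_eq_iff[OF inj, of "{u, v}" e] e uv by auto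
      then show "{u, v} \<in> edges T" using e by simp
    next
      assume "{u, v} \<in> edges T"
      then have "f ` {u, v} \<in> edges S" by (auto simp: S image_graph_def simp del: image_insert)
      then show "{f u, f v} \<in> edges S" by simp
    qed
    then show "{x, y} \<in> edges S \<longleftrightarrow> {inv_into (verts T) f x, inv_into (verts T) f y} \<in> edges T"
      using uv inj by simp
  qed
  ultimately show "S \<in> copies G T" by (simp add: copies_def)
qed

lemma free_of_iff_embeddings:
  assumes "simple_graph T"
  shows "free_of G T \<longleftrightarrow> embeddings T G = {}"
proof -
  have "free_of G T \<longleftrightarrow> copies G T = {}" by (auto simp: free_of_def copies_def)
  then show ?thesis by (simp add: copies_eq_image_graph[OF assms])
qed

text \<open>If \<open>f\<close> and \<open>g\<close> have the same image, then the inverse of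
  \<open>f\<close> composed with \<open>g\<close> is an automorphism of \<open>T\<close>. This makes
  all fibers equally large.\<close>

lemma image_graph_fiber:
  assumes T: "simple_graph T" and f: "f \<in> embeddings T G"
  shows "{g \<in> embeddings T G. image_graph g T = image_graph f T} =
    (\<lambda>h. compose (verts T) f h) ` automorphisms T"
proof (intro equalityI subsetI)
  have inj: "inj_on f (verts T)" using f by (simp add: embeddings_def)
  have sub: "e \<subseteq> verts T" if "e \<in> edges T" for e using T that by (auto simp: simple_graph_def)
  fix g assume "g \<in> {g \<in> embeddings T G. image_graph g T = image_graph f T}"
  then have g: "g \<in> embeddings T G" "inj_on g (verts T)" "g ` verts T = f ` verts T"
    "(`) g ` edges T = (`) f ` edges T"
    by (auto simp: embeddings_def image_graph_def)
  define h where "h = restrict (inv_into (verts T) f \<circ> g) (verts T)"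
  have fh: "f (h t) = g t" "h t \<in> verts T" if "t \<in> verts T" for t
  proof -
    have "g t \<in> f ` verts T" using g(3) that by blast
    then show "f (h t) = g t" "h t \<in> verts T"
      using that by (simp_all add: h_def f_inv_into_f inv_into_into)
  qed
  have "inj_on h (verts T)" using g(2) fh by (metis inj_onD inj_onI)
  moreover have "h ` verts T = verts T"
  proof (intro equalityI subsetI)
    fix t assume t: "t \<in> verts T"
    then obtain s where s: "s \<in> verts T" "f t = g s" using g(3) by (metis imageE imageI)
    then have "h s = t" using fh inj t by (metis inj_onD)
    then show "t \<in> h ` verts T" using s by blast
  qed (use fh in auto)
  moreover have "(`) h ` edges T = edges T"
  proof -
    have im: "f ` h ` e = g ` e" "h ` e \<subseteq> verts T" if "e \<in> edges T" for e
      using fh sub[OF that] by (auto simp: image_image intro!: image_cong)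
    have "h ` e \<in> edges T" if e: "e \<in> edges T" for e
    proof -
      obtain e' where "e' \<in> edges T" "g ` e = f ` e'" using g(4) e by blast
      then show ?thesis using im[OF e] inj_on_image_eq_iff[OF inj, of "h ` e" e'] sub by auto
    qed
    moreover have "e \<in> (`) h ` edges T" if e: "e \<in> edges T" for e
    proof -
      obtain e' where "e' \<in> edges T" "f ` e = g ` e'" using g(4) e by blast
      then show ?thesis using im[of e'] inj_on_image_eq_iff[OF inj, of "h ` e'" e] sub[OF e] by auto
    qed
    ultimately show ?thesis by blast
  qed
  ultimately have "h \<in> automorphisms T"
    using fh by (auto simp: automorphisms_def bij_betw_def h_def)
  moreover have "g = compose (verts T) f h"
    using fh g(1) by (auto simp: compose_def embeddings_def fun_eq_iff PiE_def extensional_def)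
  ultimately show "g \<in> (\<lambda>h. compose (verts T) f h) ` automorphisms T" by blast
next
  have sub: "e \<subseteq> verts T" if "e \<in> edges T" for e using T that by (auto simp: simple_graph_def)
  fix g assume "g \<in> (\<lambda>h. compose (verts T) f h) ` automorphisms T"
  then obtain h where h: "h \<in> automorphisms T" and g: "g = compose (verts T) f h" by blast
  have hT: "inj_on h (verts T)" "h ` verts T = verts T" "(`) h ` edges T = edges T"
    using h by (auto simp: automorphisms_def bij_betw_def)
  have ge: "g ` e = f ` h ` e" if "e \<in> edges T" for e
    using sub[OF that] by (auto simp: g compose_def image_image intro!: image_cong)
  have "g ` verts T = f ` h ` verts T"
    by (auto simp: g compose_def image_image intro!: image_cong)
  then have gV: "g ` verts T = f ` verts T" using hT(2) by simp
  have "(`) g ` edges T = (`) f ` (`) h ` edges T"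
    by (auto simp: image_image ge intro!: image_cong)
  then have gE: "(`) g ` edges T = (`) f ` edges T" using hT by simp
  have "inj_on (f \<circ> h) (verts T)"
    using f hT by (simp add: comp_inj_on embeddings_def)
  then have "inj_on g (verts T)"
    by (subst inj_on_cong[where g = "f \<circ> h"]) (simp_all add: g compose_def)
  moreover have "g \<in> verts T \<rightarrow>\<^sub>E verts G"
  proof (rule PiE_I)
    fix t assume "t \<in> verts T"
    then have "g t \<in> f ` verts T" using gV by blast
    then show "g t \<in> verts G" using f by (auto simp: embeddings_def)
  qed (simp add: g compose_def)
  moreover have "g ` e \<in> edges G" if "e \<in> edges T" for e
  proof -
    have "g ` e \<in> (`) f ` edges T" using gE that by blast
    then show ?thesis using f by (auto simp: embeddings_def)
  qed
  ultimately show "g \<in> {g \<in> embeddings T G. image_graph g T = image_graph f T}"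
    using gV gE by (auto simp: embeddings_def image_graph_def)
qed

lemma finite_embeddings:
  assumes "finite (verts T)" "finite (verts G)"
  shows "finite (embeddings T G)"
  by (rule finite_subset[OF _ finite_PiE[OF assms(1), of "\<lambda>_. verts G"]])
     (use assms in \<open>auto simp: embeddings_def\<close>)

lemma card_embeddings:
  assumes T: "simple_graph T" "finite (verts T)" and G: "finite (verts G)"
  shows "card (embeddings T G) = card (automorphisms T) * num_copies G T"
proof -
  let ?\<phi> = "\<lambda>f. image_graph f T"
  have fib: "card {g \<in> embeddings T G. ?\<phi> g = S} = card (automorphisms T)"
    if S: "S \<in> ?\<phi> ` embeddings T G" for S
  proof -
    obtain f where f: "f \<in> embeddings T G" "S = ?\<phi> f" using S by blast
    \<comment> \<open>Since \<open>f\<close> is injective it can be cancelled on the left, so the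
      fiber has exactly as many elements as there are automorphisms.\<close>
    have "inj_on (\<lambda>h. compose (verts T) f h) (automorphisms T)"
    proof (rule inj_onI)
      fix h h' assume h: "h \<in> automorphisms T" "h' \<in> automorphisms T"
        and eq: "compose (verts T) f h = compose (verts T) f h'"
      have "h t = h' t" if "t \<in> verts T" for t
      proof -
        have "f (h t) = f (h' t)" using fun_cong[OF eq, of t] that by (simp add: compose_def)
        moreover have "h t \<in> verts T" "h' t \<in> verts T" using h that by (auto simp: automorphisms_def)
        ultimately show ?thesis using f by (auto simp: embeddings_def inj_on_def)
      qed
      then show "h = h'" using h by (auto simp: automorphisms_def intro: PiE_ext)
    qed
    then show ?thesis
      using image_graph_fiber[OF T(1) f(1)] f(2) by (simp add: card_image)
  qed
  have "card (embeddings T G) = (\<Sum>S\<in>?\<phi> ` embeddings T G. card {g \<in> embeddings T G. ?\<phi> g = S})"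
    using sum.image_gen[OF finite_embeddings[OF T(2) G], of "\<lambda>_. 1::nat" ?\<phi>] by simp
  also have "\<dots> = card (automorphisms T) * num_copies G T"
    using fib by (simp add: num_copies_def copies_eq_image_graph[OF T(1)])
  finally show ?thesis .
qed

lemma card_automorphisms_pos:
  assumes "simple_graph T" "finite (verts T)"
  shows "card (automorphisms T) > 0"
proof -
  have "finite (automorphisms T)"
    by (rule finite_subset[OF _ finite_PiE[OF assms(2), of "\<lambda>_. verts T"]])
       (use assms in \<open>auto simp: automorphisms_def\<close>)
  moreover have "restrict id (verts T) \<in> automorphisms T"
  proof -
    have "restrict id (verts T) ` e = e" if "e \<in> edges T" for e
      using assms(1) that by (auto simp: simple_graph_def image_iff subset_iff)
    then show ?thesis
      by (auto simp: automorphisms_def bij_betw_def inj_on_def)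
  qed
  ultimately show ?thesis by (auto simp: card_gt_0_iff)
qed

lemma embeddings_cycle_graph:
  "embeddings (cycle_graph m) G =
     {f \<in> {..<m} \<rightarrow>\<^sub>E verts G. inj_on f {..<m} \<and> (\<forall>i<m. {f i, f (Suc i mod m)} \<in> edges G)}"
proof -
  have "(\<forall>e\<in>edges (cycle_graph m). f ` e \<in> edges G) \<longleftrightarrow> (\<forall>i<m. {f i, f (Suc i mod m)} \<in> edges G)"
    for f :: "nat \<Rightarrow> 'a"
  proof -
    have "edges (cycle_graph m) = (\<lambda>i. {i, Suc i mod m}) ` {..<m}"
      by (auto simp: cycle_graph_def)
    then show ?thesis by (simp, simp only: Ball_def lessThan_iff)
  qed
  then show ?thesis by (simp add: embeddings_def cycle_graph_def)
qed

section \<open>Hexagons in the hypercube\<close>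

text \<open>For an index beyond the length this is the identity, so \<open>flip\<close> is an
  involution at every index.\<close>

definition flip :: "bool list \<Rightarrow> nat \<Rightarrow> bool list" where
  "flip x i = x[i := \<not> x ! i]"

lemma length_flip [simp]: "length (flip x i) = length x"
  by (simp add: flip_def)

lemma nth_flip: "i < length x \<Longrightarrow> flip x j ! i \<longleftrightarrow> x ! i \<noteq> (i = j)"
  by (auto simp: flip_def nth_list_update)

lemma flip_flip [simp]: "flip (flip x i) i = x"
  by (cases "i < length x") (simp_all add: flip_def list_update_beyond)

lemma flip_commute: "flip (flip x i) j = flip (flip x j) i"
  by (cases "i = j") (simp_all add: flip_def list_update_swap)

lemma flip_eq_flip_iff: "flip x i = flip y i \<longleftrightarrow> x = y"
  by (metis flip_flip)

lemma flip_inject: "i < length x \<Longrightarrow> flip x i = flip x j \<longleftrightarrow> i = j"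
  by (metis nth_flip)

lemma flip_neq: "i < length x \<Longrightarrow> flip x i \<noteq> x"
  by (metis nth_flip)

text \<open>Edges are unordered pairs, so membership leaves open which endpoint was listed first;
  flipping is an involution, hence either one may serve as the base.\<close>

lemma edge_hypercube_iff:
  "{x, y} \<in> edges (hypercube n) \<longleftrightarrow> length x = n \<and> (\<exists>i<n. y = flip x i)"
proof -
  have "card {i. i < n \<and> x ! i \<noteq> y ! i} = 1 \<longleftrightarrow> (\<exists>i<n. y = flip x i)"
    if "length x = n" "length y = n" for x y :: "bool list"
  proof
    assume "card {i. i < n \<and> x ! i \<noteq> y ! i} = 1"
    then obtain i where i: "{i. i < n \<and> x ! i \<noteq> y ! i} = {i}" by (auto simp: card_1_singleton_iff)
    then have "i < n" by blast
    moreover have "y = flip x i"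
      using i that by (intro nth_equalityI) (auto simp: nth_flip set_eq_iff)
    ultimately show "\<exists>i<n. y = flip x i" by blast
  next
    assume "\<exists>i<n. y = flip x i"
    then obtain i where "i < n" "y = flip x i" by blast
    then have "{i. i < n \<and> x ! i \<noteq> y ! i} = {i}" using that by (auto simp: nth_flip)
    then show "card {i. i < n \<and> x ! i \<noteq> y ! i} = 1" by simp
  qed
  then have "length x = n \<and> length y = n \<and> card {i. i < n \<and> x ! i \<noteq> y ! i} = 1
      \<longleftrightarrow> length x = n \<and> (\<exists>i<n. y = flip x i)" for x y :: "bool list"
    by auto
  then have "edges (hypercube n) = {{x, y} |x y. length x = n \<and> (\<exists>i<n. y = flip x i)}"
    by (simp add: hypercube_def)
  moreover have "(\<exists>i<n. x = flip y i) \<longleftrightarrow> (\<exists>i<n. y = flip x i)" for x y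
    by (metis flip_flip)
  ultimately show ?thesis
    by (auto simp: doubleton_eq_iff)
qed

fun trail :: "(bool list \<Rightarrow> nat \<Rightarrow> bool) \<Rightarrow> bool list \<Rightarrow> nat list \<Rightarrow> bool" where
  "trail e v [] \<longleftrightarrow> True"
| "trail e v (d # ds) \<longleftrightarrow> e v d \<and> trail e (flip v d) ds"

lemma trail_iff: "trail e v ds \<longleftrightarrow> (\<forall>k<length ds. e (foldl flip v (take k ds)) (ds ! k))"
  by (induction ds arbitrary: v) (auto simp: All_less_Suc2)

definition triples :: "'a set \<Rightarrow> ('a \<times> 'a \<times> 'a) set" where
  "triples A = {(a, b, c). a \<in> A \<and> b \<in> A \<and> c \<in> A \<and> a \<noteq> b \<and> a \<noteq> c \<and> b \<noteq> c}"

text \<open>A closed walk of length 6 without repeated vertices uses each of three directions twice, never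
  the same one twice in a row (cyclically). Up to naming the directions in the order of their first
  occurrence, this leaves four words.\<close>

definition hexagon_words :: "'a \<times> 'a \<times> 'a \<Rightarrow> 'a list set" where
  "hexagon_words = (\<lambda>(a, b, c).
     {[a, b, c, a, b, c], [a, b, c, a, c, b], [a, b, a, c, b, c], [a, b, c, b, a, c]})"

definition hexagon_dirs :: "'a set \<Rightarrow> 'a list set" where
  "hexagon_dirs A = (\<Union>t\<in>triples A. hexagon_words t)"

definition hexagons :: "(bool list \<Rightarrow> nat \<Rightarrow> bool) \<Rightarrow> nat \<Rightarrow> (bool list \<times> nat list) set" where
  "hexagons e n =
     {(v, ds). length v = n \<and> ds \<in> hexagon_dirs {..<n} \<and> trail e v ds}"

definition has_edge :: "bool list ugraph \<Rightarrow> bool list \<Rightarrow> nat \<Rightarrow> bool" where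
  "has_edge G x i \<longleftrightarrow> {x, flip x i} \<in> edges G"

lemma has_edge_flip [simp]: "has_edge G (flip x i) i = has_edge G x i"
  by (simp add: has_edge_def insert_commute)

text \<open>The value outside \<open>{..<6}\<close> is \<open>undefined\<close>, as required of the
  extensional functions in \<open>embeddings\<close>.\<close>

definition hexagon_map :: "bool list \<times> nat list \<Rightarrow> nat \<Rightarrow> bool list" where
  "hexagon_map = (\<lambda>(v, ds). \<lambda>k\<in>{..<6}. foldl flip v (take k ds))"

lemma hexagon_wordsE:
  assumes "ds \<in> hexagon_dirs A"
  obtains a b c where "a \<in> A" "b \<in> A" "c \<in> A" "a \<noteq> b" "a \<noteq> c" "b \<noteq> c"
    "ds \<in> hexagon_words (a, b, c)" "length ds = 6" "set ds \<subseteq> A"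
proof -
  from assms obtain a b c where "ds \<in> hexagon_words (a, b, c)" "(a, b, c) \<in> triples A"
    unfolding hexagon_dirs_def by (metis UN_E prod_cases3)
  with that[of a b c] show ?thesis by (auto simp: triples_def hexagon_words_def)
qed

lemma foldl_flip_hexagon_word:
  assumes "ds \<in> hexagon_words (a, b, c)"
  shows "foldl flip v ds = v"
  using assms by (intro nth_equalityI) (auto simp: hexagon_words_def nth_flip)

lemma hexagon_map_step:
  assumes ds: "ds \<in> hexagon_dirs A" and k: "k < 6"
  shows "hexagon_map (v, ds) (Suc k mod 6) = flip (hexagon_map (v, ds) k) (ds ! k)"
proof -
  have "length ds = 6" "foldl flip v ds = v"
    using ds by (metis hexagon_wordsE foldl_flip_hexagon_word)+
  then have "foldl flip v (take (Suc k mod 6) ds) = foldl flip v (take (Suc k) ds)"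
    using k by (cases "k = 5") auto
  then show ?thesis
    using k \<open>length ds = 6\<close> by (simp add: hexagon_map_def take_Suc_conv_app_nth)
qed

lemma lessThan_6: "{..<6::nat} = {0, 1, 2, 3, 4, 5}"
  by auto

lemma inj_on_hexagon_map_vertices:
  assumes "ds \<in> hexagon_dirs {..<length v}"
  shows "inj_on (hexagon_map (v, ds)) {..<6}"
proof -
  from assms obtain a b c where abc: "a < length v" "b < length v" "c < length v"
    "a \<noteq> b" "a \<noteq> c" "b \<noteq> c" "ds \<in> hexagon_words (a, b, c)"
    by (metis hexagon_wordsE lessThan_iff)
  \<comment> \<open>The walk changes only the coordinates \<open>a\<close>, \<open>b\<close>,
    \<open>c\<close>; these three alone already separate its six vertices.\<close>
  define s where "s x = (x ! a, x ! b, x ! c)" for x :: "bool list"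
  let ?f = "s \<circ> hexagon_map (v, ds)"
  have "distinct [?f 0, ?f 1, ?f 2, ?f 3, ?f 4, ?f 5]"
    using abc unfolding hexagon_words_def prod.case
    by (elim insertE emptyE; simp add: hexagon_map_def s_def nth_flip)
  then have "inj_on ?f {..<6}"
    unfolding lessThan_6 by simp
  then show ?thesis by (rule inj_on_imageI2)
qed

text \<open>In a closed walk every direction occurs an even number of times. Cyclically adjacent
  directions differ, so none occurs more than three times; hence three directions occur twice
  each.\<close>

lemma hexagon_word_if_closed:
  assumes len: "length x0 = n" and d: "d0 < n" "d1 < n" "d2 < n" "d3 < n" "d4 < n" "d5 < n"
    and ne: "d0 \<noteq> d1" "d1 \<noteq> d2" "d2 \<noteq> d3" "d3 \<noteq> d4" "d4 \<noteq> d5" "d5 \<noteq> d0"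
    and closed: "foldl flip x0 [d0, d1, d2, d3, d4, d5] = x0"
  shows "[d0, d1, d2, d3, d4, d5] \<in> hexagon_dirs {..<n}"
proof -
  have par: "((((((i = d0) \<noteq> (i = d1)) \<noteq> (i = d2)) \<noteq> (i = d3)) \<noteq> (i = d4)) \<noteq> (i = d5)) = False"
    if "i < n" for i
  proof -
    have "foldl flip x0 [d0, d1, d2, d3, d4, d5] ! i = x0 ! i" using closed by simp
    then show ?thesis using that len by (simp add: nth_flip) argo
  qed
  \<comment> \<open>The third direction to appear is \<open>d2\<close>, or \<open>d3\<close> if
    \<open>d2 = d0\<close>: then \<open>d3 = d1\<close> would force \<open>d4 = d5\<close> by
    parity.\<close>
  have "\<exists>c. c \<in> {d2, d3} \<and> d0 \<noteq> c \<and> d1 \<noteq> c \<and> [d0, d1, d2, d3, d4, d5] \<in> hexagon_words (d0, d1, c)"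
    using par[OF d(1)] par[OF d(2)] par[OF d(3)] par[OF d(4)] par[OF d(5)] par[OF d(6)] ne
    unfolding hexagon_words_def by (cases "d2 = d0") auto
  then show ?thesis
    using d ne(1) by (fastforce simp: triples_def hexagon_dirs_def)
qed

lemma bij_betw_hexagon_map:
  assumes G: "subgraph G (hypercube n)"
  shows "bij_betw hexagon_map (hexagons (has_edge G) n) (embeddings (cycle_graph 6) G)"
  unfolding bij_betw_def
proof (intro conjI inj_onI equalityI subsetI)
  fix p q assume "p \<in> hexagons (has_edge G) n" "q \<in> hexagons (has_edge G) n"
    and eq: "hexagon_map p = hexagon_map q"
  then obtain v ds w es where p: "p = (v, ds)" "length v = n"
      "ds \<in> hexagon_dirs {..<n}"
    and q: "q = (w, es)" "es \<in> hexagon_dirs {..<n}"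
    by (auto simp: hexagons_def)
  have ds: "length ds = 6" "set ds \<subseteq> {..<n}" and es: "length es = 6"
    using p(3) q(2) by (metis hexagon_wordsE)+
  have "ds ! k = es ! k" if k: "k < 6" for k
  proof -
    have "flip (hexagon_map (v, ds) k) (ds ! k) = flip (hexagon_map (v, ds) k) (es ! k)"
      using hexagon_map_step[OF p(3) k, of v] hexagon_map_step[OF q(2) k, of w] eq p q by simp
    moreover have "length (hexagon_map (v, ds) k) = n"
    proof -
      have "length (foldl flip v es) = length v" for es by (induction es arbitrary: v) auto
      then show ?thesis using k p by (simp add: hexagon_map_def)
    qed
    moreover have "ds ! k < n" using ds k by (metis lessThan_iff nth_mem subsetD)
    ultimately show ?thesis by (simp add: flip_inject)
  qed
  moreover have "v = w" using fun_cong[OF eq, of 0] p q by (simp add: hexagon_map_def)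
  ultimately show "p = q" using p q ds es by (simp add: list_eq_iff_nth_eq)
next
  fix f assume "f \<in> hexagon_map ` hexagons (has_edge G) n"
  then obtain v ds where p: "f = hexagon_map (v, ds)" "length v = n" "trail (has_edge G) v ds"
      "ds \<in> hexagon_dirs {..<n}"
    by (auto simp: hexagons_def)
  have "length ds = 6" using p(4) by (metis hexagon_wordsE)
  then have e: "{f k, f (Suc k mod 6)} \<in> edges G" if "k < 6" for k
    using p(3) hexagon_map_step[OF p(4) that, of v] that
    by (simp add: p(1) trail_iff has_edge_def hexagon_map_def)
  moreover have "f k \<in> verts G" if "k < 6" for k
    using e[OF that] G by (auto simp: subgraph_def simple_graph_def)
  moreover have "inj_on f {..<6}" using inj_on_hexagon_map_vertices[of ds v] p by simp
  ultimately show "f \<in> embeddings (cycle_graph 6) G"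
    by (auto simp: embeddings_cycle_graph p(1) hexagon_map_def)
next
  fix f assume "f \<in> embeddings (cycle_graph 6) G"
  then have f: "f \<in> {..<6} \<rightarrow>\<^sub>E verts G" "inj_on f {..<6}"
    and e: "\<And>k. k < 6 \<Longrightarrow> {f k, f (Suc k mod 6)} \<in> edges G"
    by (auto simp: embeddings_cycle_graph)
  have "\<exists>d. d < n \<and> f (Suc k mod 6) = flip (f k) d" if "k < 6" for k
    using e[OF that] G edge_hypercube_iff[of "f k" "f (Suc k mod 6)" n]
    by (auto simp: subgraph_def)
  then obtain d where d: "\<And>k. k < 6 \<Longrightarrow> d k < n"
    and step: "\<And>k. k < 6 \<Longrightarrow> f (Suc k mod 6) = flip (f k) (d k)" by metis
  have s: "f 1 = flip (f 0) (d 0)" "f 2 = flip (f 1) (d 1)" "f 3 = flip (f 2) (d 2)"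
    "f 4 = flip (f 3) (d 3)" "f 5 = flip (f 4) (d 4)" "f 0 = flip (f 5) (d 5)"
    subgoal using step[of 0] by simp
    subgoal using step[of 1] by (simp add: numeral_2_eq_2)
    subgoal using step[of 2] by simp
    subgoal using step[of 3] by simp
    subgoal using step[of 4] by simp
    subgoal using step[of 5] by simp
    done
  have len: "length (f 0) = n"
    using e[of 0] G edge_hypercube_iff[of "f 0" "f 1" n] by (auto simp: subgraph_def)
  have inj: "f i \<noteq> f j" if "i < 6" "j < 6" "i \<noteq> j" for i j
    using f(2) that by (auto simp: inj_on_def)
  define ds where "ds = [d 0, d 1, d 2, d 3, d 4, d 5]"
  then have len_ds: "length ds = 6" by simp
  have "foldl flip (f 0) ds = f 0" by (simp only: ds_def foldl.simps s[symmetric])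
  \<comment> \<open>Using a direction twice in a row would return to the vertex two steps earlier,
    against injectivity.\<close>
  moreover have "d 0 \<noteq> d 1" "d 1 \<noteq> d 2" "d 2 \<noteq> d 3" "d 3 \<noteq> d 4" "d 4 \<noteq> d 5" "d 5 \<noteq> d 0"
  proof -
    have "i \<noteq> j" if "flip (flip x i) j \<noteq> x" for x i j using that by auto
    moreover have "flip (flip (f 0) (d 0)) (d 1) \<noteq> f 0" "flip (flip (f 1) (d 1)) (d 2) \<noteq> f 1"
      "flip (flip (f 2) (d 2)) (d 3) \<noteq> f 2" "flip (flip (f 3) (d 3)) (d 4) \<noteq> f 3"
      "flip (flip (f 4) (d 4)) (d 5) \<noteq> f 4" "flip (flip (f 5) (d 5)) (d 0) \<noteq> f 5"
      using inj by (simp_all only: s[symmetric]) simp_all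
    ultimately show "d 0 \<noteq> d 1" "d 1 \<noteq> d 2" "d 2 \<noteq> d 3" "d 3 \<noteq> d 4" "d 4 \<noteq> d 5" "d 5 \<noteq> d 0"
      by blast+
  qed
  ultimately have dirs: "ds \<in> hexagon_dirs {..<n}"
    unfolding ds_def using len d by (intro hexagon_word_if_closed[of "f 0"]) auto
  have fk: "f k = foldl flip (f 0) (take k ds)" if "k < 6" for k
    using that
  proof (induction k)
    case (Suc k)
    have "ds ! k = d k"
      using Suc.prems by (auto simp: ds_def less_Suc_eq numeral_eq_Suc)
    then show ?case
      using Suc step[of k] len_ds by (simp add: take_Suc_conv_app_nth)
  qed simp
  have "trail (has_edge G) (f 0) ds"
  proof -
    have "has_edge G (f k) (ds ! k)" if "k < 6" for k
    proof -
      have "ds ! k = d k" using that by (auto simp: ds_def less_Suc_eq numeral_eq_Suc)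
      then show ?thesis using e[OF that] unfolding step[OF that] has_edge_def by simp
    qed
    then show ?thesis unfolding trail_iff len_ds using fk by metis
  qed
  then have "(f 0, ds) \<in> hexagons (has_edge G) n" using len dirs by (simp add: hexagons_def)
  moreover have "f = hexagon_map (f 0, ds)"
  proof (rule ext)
    fix k
    show "f k = hexagon_map (f 0, ds) k"
    proof (cases "k < 6")
      case True
      then show ?thesis by (simp add: hexagon_map_def flip: fk)
    next
      case False
      then show ?thesis using PiE_arb[OF f(1), of k] by (simp add: hexagon_map_def)
    qed
  qed
  ultimately show "f \<in> hexagon_map ` hexagons (has_edge G) n" by blast
qed

section \<open>Counting hexagons\<close>

text \<open>The twelve Booleans are the edges of a three-dimensional cube with directions \<open>A\<close>, \<open>B\<close>, \<open>C\<close>; the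
  indices give the position of an edge in the two other directions. With \<open>N\<close> hexagons, \<open>S\<close> vertices
  of degree 3 and \<open>m\<close> edges present, the inequality is \<open>24 N + 9 S \<le> 10 m\<close>: the first sum counts
  every hexagon twice and the last one every edge twice. Equality holds for three paths of length 3
  joining two antipodal vertices (\<open>N = 3\<close>, \<open>S = 2\<close>, \<open>m = 9\<close>).\<close>

lemma cube_inequality:
  fixes A00 A10 A01 A11 B00 B10 B01 B11 C00 C10 C01 C11 :: bool
  shows "\<not> (A00 \<and> B10 \<and> A10 \<and> B00) \<longrightarrow>
    \<not> (A01 \<and> B11 \<and> A11 \<and> B01) \<longrightarrow>
    \<not> (A00 \<and> C10 \<and> A01 \<and> C00) \<longrightarrow>
    \<not> (A10 \<and> C11 \<and> A11 \<and> C01) \<longrightarrow>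
    \<not> (B00 \<and> C01 \<and> B01 \<and> C00) \<longrightarrow>
    \<not> (B10 \<and> C11 \<and> B11 \<and> C10) \<longrightarrow>
    12 * ((of_bool (A00 \<and> B10 \<and> C11 \<and> A11 \<and> B01 \<and> C00) + (of_bool (A00 \<and> B10 \<and> C11 \<and> A11 \<and> C01 \<and> B00) +
        (of_bool (A00 \<and> B10 \<and> A10 \<and> C01 \<and> B01 \<and> C00) + of_bool (A00 \<and> B10 \<and> C11 \<and> B11 \<and> A01 \<and> C00)))) +
      (of_bool (A00 \<and> B00 \<and> C01 \<and> A11 \<and> B11 \<and> C10) + (of_bool (A00 \<and> B00 \<and> C01 \<and> A11 \<and> C11 \<and> B10) +
        (of_bool (A00 \<and> B00 \<and> A10 \<and> C11 \<and> B11 \<and> C10) + of_bool (A00 \<and> B00 \<and> C01 \<and> B01 \<and> A01 \<and> C10)))) +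
      (of_bool (A10 \<and> B10 \<and> C10 \<and> A01 \<and> B01 \<and> C01) + (of_bool (A10 \<and> B10 \<and> C10 \<and> A01 \<and> C00 \<and> B00) +
        (of_bool (A10 \<and> B10 \<and> A00 \<and> C00 \<and> B01 \<and> C01) + of_bool (A10 \<and> B10 \<and> C10 \<and> B11 \<and> A11 \<and> C01)))) +
      (of_bool (A01 \<and> B11 \<and> C11 \<and> A10 \<and> B00 \<and> C00) + (of_bool (A01 \<and> B11 \<and> C11 \<and> A10 \<and> C01 \<and> B01) +
        (of_bool (A01 \<and> B11 \<and> A11 \<and> C01 \<and> B00 \<and> C00) + of_bool (A01 \<and> B11 \<and> C11 \<and> B10 \<and> A00 \<and> C00)))) +
      (of_bool (A10 \<and> B00 \<and> C00 \<and> A01 \<and> B11 \<and> C11) + (of_bool (A10 \<and> B00 \<and> C00 \<and> A01 \<and> C10 \<and> B10) +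
        (of_bool (A10 \<and> B00 \<and> A00 \<and> C10 \<and> B11 \<and> C11) + of_bool (A10 \<and> B00 \<and> C00 \<and> B01 \<and> A11 \<and> C11)))) +
      (of_bool (A01 \<and> B01 \<and> C01 \<and> A10 \<and> B10 \<and> C10) + (of_bool (A01 \<and> B01 \<and> C01 \<and> A10 \<and> C11 \<and> B11) +
        (of_bool (A01 \<and> B01 \<and> A11 \<and> C11 \<and> B10 \<and> C10) + of_bool (A01 \<and> B01 \<and> C01 \<and> B00 \<and> A00 \<and> C10)))) +
      (of_bool (A11 \<and> B11 \<and> C10 \<and> A00 \<and> B00 \<and> C01) + (of_bool (A11 \<and> B11 \<and> C10 \<and> A00 \<and> C00 \<and> B01) +
        (of_bool (A11 \<and> B11 \<and> A01 \<and> C00 \<and> B00 \<and> C01) + of_bool (A11 \<and> B11 \<and> C10 \<and> B10 \<and> A10 \<and> C01)))) +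
      (of_bool (A11 \<and> B01 \<and> C00 \<and> A00 \<and> B10 \<and> C11) + (of_bool (A11 \<and> B01 \<and> C00 \<and> A00 \<and> C10 \<and> B11) +
        (of_bool (A11 \<and> B01 \<and> A01 \<and> C10 \<and> B10 \<and> C11) + of_bool (A11 \<and> B01 \<and> C00 \<and> B00 \<and> A10 \<and> C11))))) +
    9 * (of_bool (A00 \<and> B00 \<and> C00) +
      of_bool (A00 \<and> B10 \<and> C10) +
      of_bool (A10 \<and> B00 \<and> C01) +
      of_bool (A01 \<and> B01 \<and> C00) +
      of_bool (A10 \<and> B10 \<and> C11) +
      of_bool (A01 \<and> B11 \<and> C10) +
      of_bool (A11 \<and> B01 \<and> C01) +
      of_bool (A11 \<and> B11 \<and> C11))
    \<le> (5 * ((of_bool A00 + of_bool B00 + of_bool C00) +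
      (of_bool A00 + of_bool B10 + of_bool C10) +
      (of_bool A10 + of_bool B00 + of_bool C01) +
      (of_bool A01 + of_bool B01 + of_bool C00) +
      (of_bool A10 + of_bool B10 + of_bool C11) +
      (of_bool A01 + of_bool B11 + of_bool C10) +
      (of_bool A11 + of_bool B01 + of_bool C01) +
      (of_bool A11 + of_bool B11 + of_bool C11)) :: nat)"
  \<comment> \<open>The 4096 cases are split one direction at a time, simplifying in between so that
    the terms shrink before the next four Booleans are split.\<close>
  by (induct A00; induct A10; induct A01; induct A11; 
    simp only: simp_thms of_bool_eq add_0_left add_0_right;
    (induct B00; induct B10; induct B01; induct B11; 
    simp only: simp_thms of_bool_eq add_0_left add_0_right;
      (induct C00; induct C10; induct C01; induct C11; simp)?)?)

section \<open>Sums over ordered triples of directions\<close>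

lemma finite_triples [simp]: "finite A \<Longrightarrow> finite (triples A)"
  by (rule finite_subset[of _ "A \<times> A \<times> A"]) (auto simp: triples_def)

lemma sum_triples:
  assumes "finite A"
  shows "(\<Sum>(a, b, c)\<in>triples A. f a b c) = (\<Sum>a\<in>A. \<Sum>b\<in>A - {a}. \<Sum>c\<in>A - {a, b}. f a b c)"
proof -
  have "triples A = (SIGMA a:A. SIGMA b:A - {a}. A - {a, b})" by (auto simp: triples_def)
  then show ?thesis using assms by (simp add: sum.Sigma)
qed

lemma sum_triples_fst:
  fixes g :: "'a \<Rightarrow> nat"
  assumes "finite A"
  shows "(\<Sum>(a, b, c)\<in>triples A. g a) = (card A - 1) * (card A - 2) * (\<Sum>a\<in>A. g a)"
proof -
  have "(\<Sum>b\<in>A - {a}. \<Sum>c\<in>A - {a, b}. g a) = (card A - 1) * (card A - 2) * g a" if a: "a \<in> A" for a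
  proof -
    have "card (A - {a, b}) = card A - 2" if "b \<in> A - {a}" for b
      using a that assms by (auto simp: card_Diff_subset card_insert_if)
    then have "(\<Sum>b\<in>A - {a}. \<Sum>c\<in>A - {a, b}. g a) = (\<Sum>b\<in>A - {a}. (card A - 2) * g a)"
      by (intro sum.cong) simp_all
    then show ?thesis using a assms by simp
  qed
  then show ?thesis by (simp add: sum_triples[OF assms] sum_distrib_left)
qed

lemma card_triples:
  assumes "finite A"
  shows "card (triples A) = card A * (card A - 1) * (card A - 2)"
  using sum_triples_fst[OF assms, of "\<lambda>_. 1"] by (simp add: case_prod_unfold)

lemma sum_triples_swap12: "(\<Sum>(a, b, c)\<in>triples A. f a b c) = (\<Sum>(a, b, c)\<in>triples A. f b a c)"
  by (rule sum.reindex_bij_witness[of _ "\<lambda>(a, b, c). (b, a, c)" "\<lambda>(a, b, c). (b, a, c)"])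
    (auto simp: triples_def)

lemma sum_triples_swap13: "(\<Sum>(a, b, c)\<in>triples A. f a b c) = (\<Sum>(a, b, c)\<in>triples A. f c b a)"
  by (rule sum.reindex_bij_witness[of _ "\<lambda>(a, b, c). (c, b, a)" "\<lambda>(a, b, c). (c, b, a)"])
    (auto simp: triples_def)

lemma sum_of_bool_triples:
  assumes "finite A"
  shows "(\<Sum>(a, b, c)\<in>triples A. of_bool (P a \<and> P b \<and> P c) :: nat) =
    card {a\<in>A. P a} * (card {a\<in>A. P a} - 1) * (card {a\<in>A. P a} - 2)"
proof -
  have "(\<Sum>(a, b, c)\<in>triples A. of_bool (P a \<and> P b \<and> P c) :: nat) =
      (\<Sum>t\<in>triples A. of_bool (t \<in> triples {a\<in>A. P a}))"
    by (intro sum.cong) (auto simp: triples_def)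
  also have "\<dots> = card (triples {a\<in>A. P a})"
  proof -
    have "triples A \<inter> triples {a\<in>A. P a} = triples {a\<in>A. P a}" by (auto simp: triples_def)
    then show ?thesis using assms by (simp add: Int_def)
  qed
  finally show ?thesis using assms by (simp add: card_triples)
qed

lemma finite_hexagon_words [simp]: "finite (hexagon_words t)"
  by (cases t) (simp add: hexagon_words_def)

text \<open>The bracketing is that of \<open>cube_inequality\<close>, against which the sum is later
  matched syntactically.\<close>

lemma sum_hexagon_words:
  assumes "(a, b, c) \<in> triples A"
  shows "(\<Sum>ds\<in>hexagon_words (a, b, c). g ds) =
    g [a, b, c, a, b, c] + (g [a, b, c, a, c, b] + (g [a, b, a, c, b, c] + g [a, b, c, b, a, c]))"
  using assms by (auto simp: hexagon_words_def triples_def)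

text \<open>The order in which directions first occur in a word recovers the triple, so different
  triples have disjoint sets of words.\<close>

lemma sum_hexagon_dirs:
  assumes "finite A"
  shows "(\<Sum>ds\<in>hexagon_dirs A. g ds) = (\<Sum>t\<in>triples A. \<Sum>ds\<in>hexagon_words t. g ds)"
  unfolding hexagon_dirs_def
proof (rule sum.UNION_disjoint)
  show "\<forall>s\<in>triples A. \<forall>t\<in>triples A. s \<noteq> t \<longrightarrow> hexagon_words s \<inter> hexagon_words t = {}"
    by (auto simp: hexagon_words_def triples_def)
qed (use assms in auto)

lemma finite_lists_length [simp]: "finite {v :: bool list. length v = n}"
  using finite_lists_length_eq[of "UNIV :: bool set" n] by simp

lemma card_lists_length [simp]: "card {v :: bool list. length v = n} = 2 ^ n"
  using card_lists_length_eq[of "UNIV :: bool set" n] by simp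

lemma card_hexagons:
  "card (hexagons e n) =
    (\<Sum>v | length v = n. \<Sum>t\<in>triples {..<n}. \<Sum>ds\<in>hexagon_words t. of_bool (trail e v ds))"
proof -
  have fin: "finite (hexagon_dirs {..<n})" by (simp add: hexagon_dirs_def)
  have "hexagons e n = (SIGMA v:{v. length v = n}. {ds \<in> hexagon_dirs {..<n}. trail e v ds})"
    by (auto simp: hexagons_def)
  then have "card (hexagons e n) = (\<Sum>v | length v = n. card {ds \<in> hexagon_dirs {..<n}. trail e v ds})"
    using fin by simp
  also have "\<dots> = (\<Sum>v | length v = n. \<Sum>ds\<in>hexagon_dirs {..<n}. of_bool (trail e v ds))"
    using fin by (simp add: Int_def)
  finally show ?thesis by (simp add: sum_hexagon_dirs)
qed

section \<open>Averaging over three-dimensional subcubes\<close>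

lemma sum_flip: "(\<Sum>v | length v = n. f (flip v i)) = (\<Sum>v | length v = n. f v)"
  by (rule sum.reindex_bij_witness[of _ "\<lambda>v. flip v i" "\<lambda>v. flip v i"]) auto

text \<open>The vertices come in the same order as in \<open>cube_inequality\<close>.\<close>

definition cube_sum :: "(bool list \<Rightarrow> 'b::comm_monoid_add) \<Rightarrow> bool list \<Rightarrow> nat \<Rightarrow> nat \<Rightarrow> nat \<Rightarrow> 'b" where
  "cube_sum f v a b c =
     f v + f (flip v a) + f (flip v b) + f (flip v c) + f (flip (flip v a) b) +
     f (flip (flip v a) c) + f (flip (flip v b) c) + f (flip (flip (flip v a) b) c)"

text \<open>Each flip permutes the vertices, so each of the eight summands contributes the full
  sum.\<close>

lemma sum_cube_sum:
  fixes f :: "bool list \<Rightarrow> nat"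
  shows "(\<Sum>v | length v = n. cube_sum f v a b c) = 8 * (\<Sum>v | length v = n. f v)"
proof -
  have "8 * x = x + x + x + x + x + x + x + x" for x :: nat
    by simp
  then show ?thesis using sum_flip[of f] sum_flip[of "\<lambda>v. f (flip v b)" a n] sum_flip[of "\<lambda>v. f (flip v c)" a n]
    sum_flip[of "\<lambda>v. f (flip v c)" b n] sum_flip[of "\<lambda>v. f (flip (flip v b) c)" a n]
    by (simp only: cube_sum_def sum.distrib sum_flip)
qed

text \<open>The counting needs only a predicate for the presence of an edge, given by an endpoint
  and a direction; \<open>edge_flip\<close> says that both endpoints agree.\<close>

locale square_free_cube =
  fixes e :: "bool list \<Rightarrow> nat \<Rightarrow> bool" and n :: nat
  assumes edge_flip: "e (flip v i) i = e v i"
    and square_free: "\<lbrakk>length v = n; i < n; j < n; i \<noteq> j\<rbrakk>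
      \<Longrightarrow> \<not> (e v i \<and> e (flip v i) j \<and> e (flip v j) i \<and> e v j)"
begin

lemma edge_flip2: "e (flip (flip v i) j) i = e (flip v j) i"
  by (metis edge_flip flip_commute)

lemma edge_flip3: "e (flip (flip (flip v i) j) k) i = e (flip (flip v j) k) i"
  by (metis edge_flip flip_commute)

lemma cube_sum_inequality:
  assumes v: "length v = n" and abc: "(a, b, c) \<in> triples {..<n}"
  shows "12 * cube_sum (\<lambda>v. \<Sum>ds\<in>hexagon_words (a, b, c). of_bool (trail e v ds)) v a b c +
    9 * cube_sum (\<lambda>v. of_bool (e v a \<and> e v b \<and> e v c)) v a b c
    \<le> (5 * cube_sum (\<lambda>v. of_bool (e v a) + of_bool (e v b) + of_bool (e v c)) v a b c :: nat)"
proof -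
  \<comment> \<open>Sorting the flips with \<open>a\<close> innermost, and then dropping a flip
    along an edge's own direction, leaves twelve normal forms: the Booleans of
    \<open>cube_inequality\<close>.\<close>
  note order = flip_commute[of _ b a] flip_commute[of _ c a] flip_commute[of _ c b]
  have "a < n" "b < n" "c < n" "a \<noteq> b" "a \<noteq> c" "b \<noteq> c" using abc by (auto simp: triples_def)
  \<comment> \<open>The six faces of the subcube: three through \<open>v\<close> and the three
    opposite ones.\<close>
  note sq = square_free[OF v \<open>a < n\<close> \<open>b < n\<close> \<open>a \<noteq> b\<close>] square_free[OF v \<open>a < n\<close> \<open>c < n\<close> \<open>a \<noteq> c\<close>]
    square_free[OF v \<open>b < n\<close> \<open>c < n\<close> \<open>b \<noteq> c\<close>]
    square_free[of "flip v c", OF _ \<open>a < n\<close> \<open>b < n\<close> \<open>a \<noteq> b\<close>]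
    square_free[of "flip v b", OF _ \<open>a < n\<close> \<open>c < n\<close> \<open>a \<noteq> c\<close>]
    square_free[of "flip v a", OF _ \<open>b < n\<close> \<open>c < n\<close> \<open>b \<noteq> c\<close>]
  show ?thesis
    using sq v cube_inequality[where ?A00.0 = "e v a" and ?A10.0 = "e (flip v b) a"
        and ?A01.0 = "e (flip v c) a" and ?A11.0 = "e (flip (flip v b) c) a"
        and ?B00.0 = "e v b" and ?B10.0 = "e (flip v a) b"
        and ?B01.0 = "e (flip v c) b" and ?B11.0 = "e (flip (flip v a) c) b"
        and ?C00.0 = "e v c" and ?C10.0 = "e (flip v a) c"
        and ?C01.0 = "e (flip v b) c" and ?C11.0 = "e (flip (flip v a) b) c"]
    unfolding cube_sum_def sum_hexagon_words[OF abc] trail.simps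
    by (simp only: order flip_flip edge_flip edge_flip2 edge_flip3 simp_thms length_flip)
qed

end

text \<open>Summing over all base vertices introduces the factor 8 from \<open>sum_cube_sum\<close>
  in every term, and it cancels.\<close>

lemma (in square_free_cube) sum_cube_inequality:
  assumes abc: "(a, b, c) \<in> triples {..<n}"
  shows "12 * (\<Sum>v | length v = n. \<Sum>ds\<in>hexagon_words (a, b, c). of_bool (trail e v ds)) +
    9 * (\<Sum>v | length v = n. of_bool (e v a \<and> e v b \<and> e v c))
    \<le> (5 * (\<Sum>v | length v = n. of_bool (e v a) + of_bool (e v b) + of_bool (e v c)) :: nat)"
    (is "12 * sum ?F _ + 9 * sum ?S _ \<le> 5 * sum ?E _")
proof -
  have "(\<Sum>v | length v = n. 12 * cube_sum ?F v a b c + 9 * cube_sum ?S v a b c)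
      \<le> (\<Sum>v | length v = n. 5 * cube_sum ?E v a b c)"
    using cube_sum_inequality[OF _ abc] by (intro sum_mono) simp
  then show ?thesis
    unfolding sum.distrib sum_distrib_left[symmetric] sum_cube_sum by linarith
qed

text \<open>Sum over all triples and exchange the sums. The vertices of degree 3 in subcubes become
  ordered triples of edges at \<open>v\<close>; on the right each of the three positions gives
  \<open>(n - 1) * (n - 2) * deg v\<close>, whence 15 = 5 * 3.\<close>

lemma (in square_free_cube) hexagons_degree_inequality:
  defines "deg v \<equiv> card {i \<in> {..<n}. e v i}"
  shows "12 * card (hexagons e n) + 9 * (\<Sum>v | length v = n. deg v * (deg v - 1) * (deg v - 2))
    \<le> 15 * ((n - 1) * (n - 2) * (\<Sum>v | length v = n. deg v))"
proof -
  let ?T = "triples {..<n}" and ?V = "{v :: bool list. length v = n}"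
  have H: "card (hexagons e n) =
      (\<Sum>t\<in>?T. \<Sum>v\<in>?V. \<Sum>ds\<in>hexagon_words t. of_bool (trail e v ds))"
    unfolding card_hexagons by (rule sum.swap)
  have S: "(\<Sum>v\<in>?V. deg v * (deg v - 1) * (deg v - 2)) =
      (\<Sum>(a, b, c)\<in>?T. \<Sum>v\<in>?V. of_bool (e v a \<and> e v b \<and> e v c))"
    unfolding deg_def sum_of_bool_triples[OF finite_lessThan, symmetric] case_prod_unfold
    by (rule sum.swap)
  have E1: "(\<Sum>(a, b, c)\<in>?T. of_bool (e v a) + of_bool (e v b) + of_bool (e v c)) =
      3 * ((n - 1) * (n - 2) * deg v)" for v
  proof -
    have *: "(\<Sum>(a, b, c)\<in>?T. of_bool (e v a)) = (n - 1) * (n - 2) * deg v"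
      using sum_triples_fst[of "{..<n}" "\<lambda>i. of_bool (e v i)"] by (simp add: deg_def Int_def)
    have "(\<Sum>(a, b, c)\<in>?T. of_bool (e v b)) = (n - 1) * (n - 2) * deg v"
      using * by (subst sum_triples_swap12)
    moreover have "(\<Sum>(a, b, c)\<in>?T. of_bool (e v c)) = (n - 1) * (n - 2) * deg v"
      using * by (subst sum_triples_swap13)
    ultimately show ?thesis using * by (simp add: case_prod_unfold sum.distrib)
  qed
  have E: "(\<Sum>(a, b, c)\<in>?T. \<Sum>v\<in>?V. of_bool (e v a) + of_bool (e v b) + of_bool (e v c)) =
      3 * ((n - 1) * (n - 2) * (\<Sum>v\<in>?V. deg v))"
  proof -
    have "(\<Sum>(a, b, c)\<in>?T. \<Sum>v\<in>?V. of_bool (e v a) + of_bool (e v b) + of_bool (e v c) :: nat) =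
        (\<Sum>v\<in>?V. \<Sum>(a, b, c)\<in>?T. of_bool (e v a) + of_bool (e v b) + of_bool (e v c))"
      unfolding case_prod_unfold by (rule sum.swap)
    then show ?thesis by (simp only: E1 sum_distrib_left)
  qed
  have "(\<Sum>(a, b, c)\<in>?T.
        12 * (\<Sum>v\<in>?V. \<Sum>ds\<in>hexagon_words (a, b, c). of_bool (trail e v ds)) +
        9 * (\<Sum>v\<in>?V. of_bool (e v a \<and> e v b \<and> e v c)) :: nat)
      \<le> (\<Sum>(a, b, c)\<in>?T. 5 * (\<Sum>v\<in>?V. of_bool (e v a) + of_bool (e v b) + of_bool (e v c)))"
    using sum_cube_inequality by (intro sum_mono) (auto split: prod.split)
  then have "12 * card (hexagons e n) + 9 * (\<Sum>v\<in>?V. deg v * (deg v - 1) * (deg v - 2))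
      \<le> 5 * (3 * ((n - 1) * (n - 2) * (\<Sum>v\<in>?V. deg v)))"
    unfolding H S E[symmetric]
    by (simp add: case_prod_unfold sum.distrib sum_distrib_left)
  then show ?thesis by simp
qed

text \<open>For \<open>d = y n\<close> and large \<open>n\<close> this is \<open>15 y - 9 y\<^sup>3 < 7.8\<close>, which follows from the tangent
  bound for \<open>y\<^sup>3\<close> at \<open>y = 3/4\<close>.\<close>

lemma degree_inequality:
  fixes n d :: nat
  assumes n: "n \<ge> 300" and d: "d \<le> n"
  shows "15 * ((real n - 1) * ((real n - 2) * real d)) - 9 * real (d * (d - 1) * (d - 2))
    \<le> 7.8 * (real n * (real n - 1) * (real n - 2))"
proof -
  define x y where "x = real n" and "y = real d"
  have xy: "x \<ge> 300" "y \<ge> 0" "y \<le> x" using assms by (auto simp: x_def y_def)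
  have "real (d * (d - 1) * (d - 2)) = y * (y - 1) * (y - 2)"
  proof (cases "d \<ge> 2")
    case False
    then have "d = 0 \<or> d = 1" by auto
    then show ?thesis by (auto simp: y_def)
  qed (simp add: y_def)
  also have "y * (y - 1) * (y - 2) \<ge> 27 / 16 * (x^2 * y) - 27 / 32 * x^3 - 3 * x^2"
  proof -
    \<comment> \<open>With \<open>t = 3 / 4 * x\<close> this is the factorization of
      \<open>y^3 - 3 * t^2 * y + 2 * t^3\<close>, which has a double root at
      \<open>t\<close>.\<close>
    have "(y - 3 / 4 * x)^2 * (y + 3 / 2 * x) \<ge> 0" using xy by simp
    moreover have "(y - 3 / 4 * x)^2 * (y + 3 / 2 * x) = y^3 - 27 / 16 * (x^2 * y) + 27 / 32 * x^3"
      by (simp add: power2_eq_square power3_eq_cube field_simps)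
    moreover have "y * (y - 1) * (y - 2) = y^3 - 3 * y^2 + 2 * y"
      by (simp add: power2_eq_square power3_eq_cube algebra_simps)
    moreover have "y^2 \<le> x^2" using xy by (simp add: power_mono)
    ultimately show ?thesis using xy by linarith
  qed
  finally have 1: "real (d * (d - 1) * (d - 2)) \<ge> 27 / 16 * (x^2 * y) - 27 / 32 * x^3 - 3 * x^2" .
  have "(x - 1) * (x - 2) \<le> x^2" using xy by (simp add: power2_eq_square algebra_simps)
  then have 2: "(x - 1) * ((x - 2) * y) \<le> x^2 * y"
    using xy by (simp add: mult_right_mono flip: mult.assoc)
  have 3: "x^2 * y \<ge> 0" using xy by simp
  have "300 * x^2 \<le> x * x^2" using xy by (intro mult_right_mono) auto
  then have 4: "300 * x^2 \<le> x^3" by (simp add: power3_eq_cube power2_eq_square)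
  have 5: "x * (x - 1) * (x - 2) \<ge> x^3 - 3 * x^2"
    using xy by (simp add: power2_eq_square power3_eq_cube algebra_simps)
  have "15 * ((x - 1) * ((x - 2) * y)) - 9 * real (d * (d - 1) * (d - 2)) \<le> 7.8 * (x * (x - 1) * (x - 2))"
  proof -
    \<comment> \<open>The coefficient 15 - 243/16 of \<open>u\<close> is negative. Beyond that,
      243/32 = 7.59375 leaves 0.20625 \<open>w\<close>, which covers the error 50.4 \<open>q\<close>
      because \<open>300 * q \<le> w\<close>; this is where the threshold 300 enters.\<close>
    have "15 * P - 9 * Q \<le> 7.8 * R"
      if "Q \<ge> 27 / 16 * u - 27 / 32 * w - 3 * q" "P \<le> u" "u \<ge> 0" "300 * q \<le> w" "R \<ge> w - 3 * q" "q \<ge> 0"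
      for P Q R u w q :: real
      using that by linarith
    from this[OF 1 2 3 4 5] show ?thesis by simp
  qed
  then show ?thesis by (simp add: x_def y_def)
qed

text \<open>Summing \<open>degree_inequality\<close> over the vertices gives the constant 0.65 = 7.8
  / 12.\<close>

lemma (in square_free_cube) card_hexagons_le:
  assumes n: "n \<ge> 300"
  shows "real (card (hexagons e n)) \<le> 0.65 * (2 ^ n * (real n * (real n - 1) * (real n - 2)))"
proof -
  define deg where "deg v = card {i \<in> {..<n}. e v i}" for v
  have "deg v \<le> n" for v
    using card_mono[of "{..<n}" "{i \<in> {..<n}. e v i}"] by (auto simp: deg_def)
  then have "(\<Sum>v | length v = n. 15 * ((real n - 1) * ((real n - 2) * real (deg v)))
        - 9 * real (deg v * (deg v - 1) * (deg v - 2)))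
      \<le> (\<Sum>v :: bool list | length v = n. 7.8 * (real n * (real n - 1) * (real n - 2)))"
    using degree_inequality[OF n] by (intro sum_mono) blast
  then have 1: "15 * ((real n - 1) * ((real n - 2) * (\<Sum>v | length v = n. real (deg v))))
        - 9 * (\<Sum>v | length v = n. real (deg v * (deg v - 1) * (deg v - 2)))
      \<le> 2 ^ n * (7.8 * (real n * (real n - 1) * (real n - 2)))"
    by (simp add: sum_subtractf flip: sum_distrib_left)
  have "real (12 * card (hexagons e n) + 9 * (\<Sum>v | length v = n. deg v * (deg v - 1) * (deg v - 2)))
    \<le> real (15 * ((n - 1) * (n - 2) * (\<Sum>v | length v = n. deg v)))"
    using hexagons_degree_inequality unfolding deg_def of_nat_le_iff by simp
  also have "real (15 * ((n - 1) * (n - 2) * (\<Sum>v | length v = n. deg v))) =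
      15 * ((real n - 1) * ((real n - 2) * (\<Sum>v | length v = n. real (deg v))))"
    using n by (simp add: of_nat_diff mult.assoc)
  finally have "12 * real (card (hexagons e n))
      + 9 * (\<Sum>v | length v = n. real (deg v * (deg v - 1) * (deg v - 2)))
    \<le> 15 * ((real n - 1) * ((real n - 2) * (\<Sum>v | length v = n. real (deg v))))"
    by simp
  with 1 show ?thesis by simp
qed

section \<open>From graphs to edge predicates\<close>

lemma card_embeddings_C6:
  assumes "subgraph G (hypercube n)"
  shows "card (embeddings (cycle_graph 6) G) = card (hexagons (has_edge G) n)"
  using bij_betw_same_card[OF bij_betw_hexagon_map[OF assms]] by simp

lemma has_edge_hypercube: "has_edge (hypercube n) v i \<longleftrightarrow> length v = n \<and> i < n"
  by (auto simp: has_edge_def edge_hypercube_iff) (metis flip_inject)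

lemma subgraph_refl: "simple_graph G \<Longrightarrow> subgraph G G"
  by (simp add: subgraph_def)

text \<open>With all edges present, each of the four words of a triple is a trail from every
  vertex.\<close>

lemma card_hexagons_hypercube:
  "card (hexagons (has_edge (hypercube n)) n) = 4 * (2 ^ n * (n * (n - 1) * (n - 2)))"
proof -
  have "(\<Sum>ds\<in>hexagon_words t. of_bool (trail (has_edge (hypercube n)) v ds)) = (4 :: nat)"
    if "t \<in> triples {..<n}" "length v = n" for t v
  proof -
    obtain a b c where t: "t = (a, b, c)" by (cases t)
    then have "a < n" "b < n" "c < n" using that by (auto simp: triples_def)
    then show ?thesis
      unfolding t using that by (subst sum_hexagon_words) (auto simp: t has_edge_hypercube)
  qed
  then have "card (hexagons (has_edge (hypercube n)) n) = (\<Sum>v :: bool list | length v = n. \<Sum>t\<in>triples {..<n}. 4)"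
    unfolding card_hexagons by (intro sum.cong) auto
  then show ?thesis by (simp add: card_triples)
qed

lemma Suc_mod_4: "Suc 0 mod 4 = 1" "Suc 1 mod 4 = 2" "Suc 2 mod 4 = 3" "Suc 3 mod 4 = 0"
  by simp_all

text \<open>The corners of a square with all four edges, taken in cyclic order, would be an
  embedding of C4.\<close>

lemma square_free_cube_if_free_of_C4:
  assumes G: "subgraph G (hypercube n)" and free: "free_of G (cycle_graph 4)"
  shows "square_free_cube (has_edge G) n"
proof
  fix v :: "bool list" and i j assume v: "length v = n" "i < n" "j < n" "i \<noteq> j"
  show "\<not> (has_edge G v i \<and> has_edge G (flip v i) j \<and> has_edge G (flip v j) i \<and> has_edge G v j)"
  proof
    assume e: "has_edge G v i \<and> has_edge G (flip v i) j \<and> has_edge G (flip v j) i \<and> has_edge G v j"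
    define f where "f = restrict ((!) [v, flip v i, flip (flip v i) j, flip v j]) {..<4}"
    have four: "{..<4::nat} = {0, 1, 2, 3}" by auto
    have f: "f 0 = v" "f 1 = flip v i" "f 2 = flip (flip v i) j" "f 3 = flip v j"
      by (simp_all add: f_def)
    have "{f k, f (Suc k mod 4)} \<in> edges G" if "k < 4" for k
    proof -
      have "k = 0 \<or> k = 1 \<or> k = 2 \<or> k = 3" using that by auto
      moreover have "{f 0, f 1} \<in> edges G" "{f 1, f 2} \<in> edges G" "{f 2, f 3} \<in> edges G" "{f 3, f 0} \<in> edges G"
        using e by (simp_all only: f has_edge_def insert_commute flip_commute[of v i j])
      ultimately show ?thesis by (elim disjE; hypsubst; simp only: Suc_mod_4)
    qed
    moreover from this have "f k \<in> verts G" if "k < 4" for k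
      using that G by (force simp: subgraph_def simple_graph_def)
    moreover have "inj_on f {..<4}"
    proof -
      have "flip v i \<noteq> v" "flip v j \<noteq> v" "flip (flip v i) j \<noteq> flip v i" "flip v i \<noteq> flip v j"
        "flip (flip v i) j \<noteq> flip v j"
        using v by (simp_all add: flip_neq flip_inject flip_eq_flip_iff)
      moreover have "flip (flip v i) j \<noteq> v" using v by (metis flip_flip flip_inject)
      ultimately have "distinct [f 0, f 1, f 2, f 3]" unfolding f by auto
      then show ?thesis unfolding four by simp
    qed
    ultimately have "f \<in> embeddings (cycle_graph 4) G"
      by (auto simp: embeddings_cycle_graph f_def)
    then show False
      using free by (simp add: free_of_iff_embeddings simple_graph_cycle_graph)
  qed
qed simp

section \<open>The layer graph\<close>

definition parity :: "bool list \<Rightarrow> bool" where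
  "parity x = foldr (\<noteq>) x False"

lemma parity_flip: "i < length x \<Longrightarrow> parity (flip x i) = (\<not> parity x)"
proof (induction x arbitrary: i)
  case (Cons b x)
  then show ?case by (cases i) (auto simp: parity_def flip_def)
qed simp

text \<open>Every edge \<open>{x, flip x i}\<close> is kept whose lower endpoint has an even number of ones; the lower
  endpoint is \<open>x\<close> iff \<open>x ! i\<close> is false.\<close>

definition layer_graph :: "nat \<Rightarrow> bool list ugraph" where
  "layer_graph n =
     ({x. length x = n}, {{x, flip x i} |x i. length x = n \<and> i < n \<and> parity x = x ! i})"

lemma subgraph_layer_graph: "subgraph (layer_graph n) (hypercube n)"
proof -
  have "edges (layer_graph n) \<subseteq> edges (hypercube n)"
    using edge_hypercube_iff by (auto simp: layer_graph_def)
  moreover have "verts (layer_graph n) = verts (hypercube n)"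
    by (simp add: layer_graph_def hypercube_def)
  ultimately show ?thesis
    using simple_graph_hypercube[of n] unfolding subgraph_def simple_graph_def by auto
qed

text \<open>Flipping coordinate \<open>i\<close> negates both the parity and \<open>x ! i\<close>,
  so the criterion agrees at the two endpoints.\<close>

lemma has_edge_layer_graph:
  assumes "length x = n" "i < n"
  shows "has_edge (layer_graph n) x i \<longleftrightarrow> parity x = x ! i"
proof
  assume "has_edge (layer_graph n) x i"
  then obtain y j where y: "length y = n" "j < n" "parity y = y ! j" "{x, flip x i} = {y, flip y j}"
    by (auto simp: has_edge_def layer_graph_def)
  then consider "x = y" "flip x i = flip x j" | "x = flip y j" "flip x i = flip x j"
    by (auto simp: doubleton_eq_iff)
  then show "parity x = x ! i"
  proof cases
    case 1
    then show ?thesis using y assms by (simp add: flip_inject)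
  next
    case 2
    then have "i = j" using assms by (metis flip_inject)
    then show ?thesis using 2(1) y by (simp add: parity_flip nth_flip)
  qed
qed (use assms in \<open>auto simp: has_edge_def layer_graph_def\<close>)

text \<open>Opposite edges of a 4-cycle have the same direction \<open>d\<close>. Crossing between
  them along \<open>a\<close> changes the parity but not coordinate \<open>d\<close>, so at most one
  of them is kept.\<close>

lemma free_of_layer_graph: "free_of (layer_graph n) (cycle_graph 4)"
proof -
  let ?G = "layer_graph n"
  have False if "f \<in> embeddings (cycle_graph 4) ?G" for f
  proof -
    have inj: "inj_on f {..<4}" using that by (simp add: embeddings_cycle_graph)
    have edge: "{f k, f (Suc k mod 4)} \<in> edges ?G" if "k < 4" for k
      using that \<open>f \<in> _\<close> by (auto simp: embeddings_cycle_graph)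
    have e: "{f 0, f 1} \<in> edges ?G" "{f 1, f 2} \<in> edges ?G" "{f 2, f 3} \<in> edges ?G" "{f 3, f 0} \<in> edges ?G"
      using edge[of 0] edge[of 1] edge[of 2] edge[of 3] unfolding Suc_mod_4 by simp_all
    have flips: "length x = n \<and> (\<exists>i<n. y = flip x i)" if "{x, y} \<in> edges ?G" for x y
      using that subgraph_layer_graph[of n] edge_hypercube_iff[of x y n] by (auto simp: subgraph_def)
    obtain a where a: "length (f 0) = n" "a < n" "f 1 = flip (f 0) a" using flips[OF e(1)] by blast
    obtain b where b: "b < n" "f 2 = flip (f 1) b" using flips[OF e(2)] by blast
    obtain d where d: "d < n" "f 3 = flip (f 0) d"
      using flips[of "f 0" "f 3"] e(4) by (auto simp: insert_commute)
    obtain c where c: "c < n" "f 2 = flip (f 3) c"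
      using flips[of "f 3" "f 2"] e(3) by (auto simp: insert_commute)
    have "f 0 \<noteq> f 2" "f 1 \<noteq> f 3"
      using inj_onD[OF inj, of 0 2] inj_onD[OF inj, of 1 3] by auto
    then have "a \<noteq> b" "a \<noteq> d" "d \<noteq> c" using a b c d by auto
    \<comment> \<open>Both routes from \<open>f 0\<close> to \<open>f 2\<close> must change
      coordinate \<open>d\<close>; on the route through \<open>f 1\<close> only \<open>b\<close> can
      do so.\<close>
    have "flip (flip (f 0) a) b ! d = flip (flip (f 0) d) c ! d" using a b c d by simp
    then have "d = b" using a d \<open>a \<noteq> d\<close> \<open>d \<noteq> c\<close> by (auto simp: nth_flip)
    have "has_edge ?G (f 0) d" using e(4) d by (simp add: has_edge_def insert_commute)
    moreover have "has_edge ?G (flip (f 0) a) d"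
      using e(2) a b \<open>d = b\<close> by (simp add: has_edge_def)
    ultimately show False
      using a d \<open>a \<noteq> d\<close> by (simp add: has_edge_layer_graph parity_flip nth_flip)
  qed
  then show ?thesis by (auto simp: free_of_iff_embeddings simple_graph_cycle_graph)
qed

text \<open>After three steps the parity and all three coordinates are negated, so the last three
  edges impose the same conditions as the first three.\<close>

lemma trail_layer_graph:
  assumes "length v = n" "(a, b, c) \<in> triples {..<n}"
    "parity v = v ! a" "v ! b = (\<not> parity v)" "v ! c = parity v"
  shows "trail (has_edge (layer_graph n)) v [a, b, c, a, b, c]"
  using assms by (auto simp: triples_def has_edge_layer_graph parity_flip nth_flip)

lemma card_hexagons_layer_graph:
  assumes n: "n \<ge> 4"
  shows "2 ^ n * (n * (n - 1) * (n - 2)) \<le> 8 * card (hexagons (has_edge (layer_graph n)) n)"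
proof -
  let ?T = "triples {..<n}" and ?V = "{v :: bool list. length v = n}"
  let ?e = "has_edge (layer_graph n)"
  have le: "2 ^ n \<le> 8 * (\<Sum>v\<in>?V. \<Sum>ds\<in>hexagon_words t. of_bool (trail ?e v ds) :: nat)" if t: "t \<in> ?T" for t
  proof -
    obtain a b c where abc: "t = (a, b, c)" by (cases t)
    then have abc': "a < n" "b < n" "c < n" "a \<noteq> b" "a \<noteq> c" "b \<noteq> c" using t by (auto simp: triples_def)
    have "\<not> {..<n} \<subseteq> {a, b, c}"
      using n abc' card_mono[of "{a, b, c}" "{..<n}"] by auto
    \<comment> \<open>Flipping \<open>a\<close> affects the three conditions in \<open>?F\<close>
      exactly as flipping \<open>b\<close> and \<open>c\<close> together does. A fourth direction is
      therefore taken: flips of \<open>b\<close>, \<open>c\<close>, \<open>d\<close> produce all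
      eight truth patterns, each once.\<close>
    then obtain d where d: "d < n" "d \<noteq> a" "d \<noteq> b" "d \<noteq> c" by auto
    let ?F = "\<lambda>v. of_bool (parity v = v ! a \<and> v ! b = (\<not> parity v) \<and> v ! c = parity v) :: nat"
    have "cube_sum ?F v b c d = 1" if "length v = n" for v
      using that abc' d
      by (auto simp: cube_sum_def parity_flip nth_flip)
    then have "2 ^ n = 8 * sum ?F ?V"
      using sum_cube_sum[of ?F b c d n] by simp
    also have "sum ?F ?V \<le> (\<Sum>v\<in>?V. \<Sum>ds\<in>hexagon_words t. of_bool (trail ?e v ds))"
    proof (rule sum_mono)
      fix v :: "bool list" assume "v \<in> ?V"
      then have "?F v \<le> of_bool (trail ?e v [a, b, c, a, b, c])"
        using trail_layer_graph[of v n a b c] t abc by auto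
      also have "\<dots> \<le> (\<Sum>ds\<in>hexagon_words t. of_bool (trail ?e v ds))"
        unfolding abc by (subst sum_hexagon_words) (use t abc in auto)
      finally show "?F v \<le> (\<Sum>ds\<in>hexagon_words t. of_bool (trail ?e v ds))" .
    qed
    finally show ?thesis by simp
  qed
  have "card ?T * 2 ^ n \<le> (\<Sum>t\<in>?T. 8 * (\<Sum>v\<in>?V. \<Sum>ds\<in>hexagon_words t. of_bool (trail ?e v ds)))"
    using sum_mono[OF le] by simp
  also have "\<dots> = 8 * card (hexagons ?e n)"
    unfolding card_hexagons sum_distrib_left[symmetric] by (subst sum.swap) simp
  finally show ?thesis by (simp add: card_triples mult.commute)
qed

section \<open>Comparison of the counts\<close>

theorem theorem6:
  "\<exists>n0. \<forall>n\<ge>n0.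
     0.03125 \<le> turan_density (hypercube n) (cycle_graph 6) (cycle_graph 4) \<and>
     turan_density (hypercube n) (cycle_graph 6) (cycle_graph 4) \<le> 0.1625"
proof (intro exI[of _ 300] allI impI)
  fix n :: nat assume n: "n \<ge> 300"
  let ?Q = "hypercube n" and ?C6 = "cycle_graph 6" and ?C4 = "cycle_graph 4"
  let ?S = "{num_copies G ?C6 | G. subgraph G ?Q \<and> free_of G ?C4}"
  \<comment> \<open>This common factor turns copies into embeddings and cancels in the density, so
    only its positivity matters.\<close>
  define k where "k = real (card (automorphisms ?C6))"
  have C6: "simple_graph ?C6" "finite (verts ?C6)"
    by (simp add: simple_graph_cycle_graph) (simp add: cycle_graph_def)
  have k: "k > 0" using card_automorphisms_pos[OF C6] by (simp add: k_def)
  have copies: "k * real (num_copies G ?C6) = real (card (hexagons (has_edge G) n))"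
    if G: "subgraph G ?Q" for G
  proof -
    have "finite (verts G)"
      using G finite_verts_hypercube[of n] by (auto simp: subgraph_def intro: finite_subset)
    then show ?thesis
      using card_embeddings[OF C6, of G] card_embeddings_C6[OF G] by (simp add: k_def)
  qed
  \<comment> \<open>In units of \<open>M\<close> the cube has 4 embeddings, an extremal graph at
    most 0.65 and the layer graph at least 1/8; the ratios are 0.1625 and 1/32 = 0.03125.\<close>
  define M where "M = 2 ^ n * (real n * (real n - 1) * (real n - 2))"
  have M: "M > 0" using n by (simp add: M_def)
  have M_nat: "real (2 ^ n * (n * (n - 1) * (n - 2))) = M"
    using n by (simp add: M_def of_nat_diff)
  have Q: "k * real (num_copies ?Q ?C6) = 4 * M"
    using copies[OF subgraph_refl[OF simple_graph_hypercube]] card_hexagons_hypercube[of n] M_nat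
    by simp
  then have Q_pos: "real (num_copies ?Q ?C6) > 0"
    using k M by (metis mult_eq_0_iff of_nat_0_less_iff of_nat_eq_0_iff less_numeral_extra(3) bot_nat_0.not_eq_extremum zero_neq_numeral)
  have fin: "finite ?S" using finite_verts_hypercube by (rule ex_set_finite)
  have "?S \<noteq> {}" by (rule ex_set_nonempty) (auto simp: cycle_graph_def lessThan_empty_iff)
  \<comment> \<open>The maximum is attained, so both bounds can be proved for one extremal graph
    \<open>G\<close>.\<close>
  then have "ex_copies ?Q ?C6 ?C4 \<in> ?S" unfolding ex_copies_def using fin by (rule Max_in[rotated])
  then obtain G where G: "subgraph G ?Q" "free_of G ?C4" "ex_copies ?Q ?C6 ?C4 = num_copies G ?C6"
    by blast
  interpret square_free_cube "has_edge G" n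
    using G by (intro square_free_cube_if_free_of_C4)
  have "k * real (num_copies G ?C6) \<le> 0.65 * M"
    using copies[OF G(1)] card_hexagons_le[OF n] by (simp add: M_def)
  then have "k * real (num_copies G ?C6) \<le> k * (0.1625 * real (num_copies ?Q ?C6))"
    using Q by (simp add: field_simps)
  then have upper: "real (num_copies G ?C6) \<le> 0.1625 * real (num_copies ?Q ?C6)"
    using k by (simp only: mult_le_cancel_left_pos)
  have "num_copies (layer_graph n) ?C6 \<le> num_copies G ?C6"
    unfolding G(3)[symmetric] ex_copies_def
    using fin subgraph_layer_graph free_of_layer_graph by (intro Max_ge) blast+
  moreover have "M \<le> 8 * (k * real (num_copies (layer_graph n) ?C6))"
    using copies[OF subgraph_layer_graph] card_hexagons_layer_graph[of n] M_nat n by linarith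
  ultimately have "M \<le> 8 * (k * real (num_copies G ?C6))"
    using k by (smt (verit) mult_left_mono of_nat_mono)
  then have "k * (0.03125 * real (num_copies ?Q ?C6)) \<le> k * real (num_copies G ?C6)"
    using Q by (simp add: field_simps)
  then have lower: "0.03125 * real (num_copies ?Q ?C6) \<le> real (num_copies G ?C6)"
    using k by (simp only: mult_le_cancel_left_pos)
  show "0.03125 \<le> turan_density ?Q ?C6 ?C4 \<and> turan_density ?Q ?C6 ?C4 \<le> 0.1625"
    unfolding turan_density_def G(3)
    using lower upper Q_pos by (simp add: pos_le_divide_eq pos_divide_le_eq)
qed

end
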